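(* For every $F\in\mathrm{et}(\mathbb{C}^2)$, the right composition operator $R_F:\mathrm{et}(\mathbb{C}^2)\to\mathrm{et}(\mathbb{C}^2)$, $R_F(G)=G\circ F$, is injective.
   Context: $\mathrm{et}(\mathbb{C}^2)$ denotes the set of all polynomial mappings $F=(P,Q)\in\mathbb{C}[X,Y]^2$, $F:\mathbb{C}^2\to\mathbb{C}^2$, such that (1) $\det J_F\equiv 1$ (Jacobian determinant), and (2) $\deg P=\deg_Y P$ and $\deg Q=\deg_Y Q$ (the total degree equals the degree in $Y$). The paper regards it as a semigroup under composition of mappings.
   Formalization: The set et(C^2) is not closed under composition (F=(Y,Y-X), G=(X-Y,Y) give G∘F=(X,Y-X)), so R_F is taken with values in all mappings of C^2; its injectivity on the whole of et(C^2) is proved for every F in et(C^2). *)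

theory Defs
  imports Complex_Main "HOL-Computational_Algebra.Polynomial"
begin

text \<open>
  The ring \<open>\<complex>[X,Y]\<close> is represented as \<open>\<complex>[X][Y]\<close>, i.e. by the type \<open>complex poly poly\<close>: the
  coefficient of \<open>X\<^sup>i Y\<^sup>j\<close> in \<open>p\<close> is \<open>coeff (coeff p j) i\<close>. Consequently the degree in \<open>Y\<close> is
  \<open>degree\<close> and the partial derivative with respect to \<open>Y\<close> is \<open>pderiv\<close>.
\<close>

definition eval2 :: "complex poly poly \<Rightarrow> complex \<times> complex \<Rightarrow> complex" where
  "eval2 p = (\<lambda>(x, y). poly (poly p [:y:]) x)"

definition total_degree :: "complex poly poly \<Rightarrow> nat" where
  "total_degree p = Max (insert 0 {i + j | i j. coeff (coeff p j) i \<noteq> 0})"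

abbreviation degree_Y :: "complex poly poly \<Rightarrow> nat" where
  "degree_Y p \<equiv> degree p"

definition pderiv_X :: "complex poly poly \<Rightarrow> complex poly poly" where
  "pderiv_X p = map_poly pderiv p"

abbreviation pderiv_Y :: "complex poly poly \<Rightarrow> complex poly poly" where
  "pderiv_Y p \<equiv> pderiv p"

definition jacobian_det :: "complex poly poly \<Rightarrow> complex poly poly \<Rightarrow> complex poly poly" where
  "jacobian_det P Q = pderiv_X P * pderiv_Y Q - pderiv_Y P * pderiv_X Q"

definition poly_mapping2 ::
  "complex poly poly \<Rightarrow> complex poly poly \<Rightarrow> complex \<times> complex \<Rightarrow> complex \<times> complex" where
  "poly_mapping2 P Q = (\<lambda>z. (eval2 P z, eval2 Q z))"

text \<open>
  Elements of \<open>et(\<complex>\<^sup>2)\<close> are mappings of \<open>\<complex>\<^sup>2\<close>. The polynomials \<open>P\<close>, \<open>Q\<close> in the definition are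
  determined by the mapping, see \<open>poly_mapping2_inject\<close> below.
\<close>

definition et :: "(complex \<times> complex \<Rightarrow> complex \<times> complex) set" where
  "et = {poly_mapping2 P Q | P Q.
           jacobian_det P Q = 1 \<and>
           total_degree P = degree_Y P \<and> total_degree Q = degree_Y Q}"

text \<open>
  The set \<open>et\<close> is not closed under composition: \<open>F = (Y, Y - X)\<close> and \<open>G = (X - Y, Y)\<close> lie in it, but
  \<open>G \<circ> F = (X, Y - X)\<close> does not. Hence the operator below takes values in all mappings of \<open>\<complex>\<^sup>2\<close>.
\<close>

definition right_comp ::
  "(complex \<times> complex \<Rightarrow> complex \<times> complex) \<Rightarrow>
   (complex \<times> complex \<Rightarrow> complex \<times> complex) \<Rightarrow> complex \<times> complex \<Rightarrow> complex \<times> complex" where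
  "right_comp F G = G \<circ> F"

lemma eval2_inject: "eval2 p = eval2 q \<longleftrightarrow> p = q"
proof
  assume eq: "eval2 p = eval2 q"
  have "poly (p - q) [:y:] = 0" for y
  proof -
    have "poly (poly p [:y:]) = poly (poly q [:y:])"
      using fun_cong[OF eq] by (force simp: eval2_def)
    then have "poly p [:y:] = poly q [:y:]" by (simp only: poly_eq_poly_eq_iff)
    then show ?thesis by simp
  qed
  then have "range (\<lambda>y. [:y:]) \<subseteq> {r. poly (p - q) r = 0}" by auto
  moreover have "infinite (range (\<lambda>y::complex. [:y:]))"
    using finite_imageD[of "\<lambda>y::complex. [:y:]" UNIV] infinite_UNIV_char_0[where ?'a = complex]
    by (auto simp: inj_on_def)
  ultimately have "infinite {r. poly (p - q) r = 0}"
    by (rule infinite_super)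
  then have "p - q = 0"
    using poly_roots_finite[of "p - q"] by argo
  then show "p = q" by simp
qed simp

lemma poly_mapping2_inject:
  "poly_mapping2 P Q = poly_mapping2 P' Q' \<longleftrightarrow> P = P' \<and> Q = Q'"
proof
  assume "poly_mapping2 P Q = poly_mapping2 P' Q'"
  then have "eval2 P z = eval2 P' z" "eval2 Q z = eval2 Q' z" for z
    by (auto simp: poly_mapping2_def dest: fun_cong[of _ _ z])
  then have "eval2 P = eval2 P'" "eval2 Q = eval2 Q'" by auto
  then show "P = P' \<and> Q = Q'" by (simp add: eval2_inject)
qed simp

end

theory Submission imports Defs begin

text \<open>
  Injectivity of \<open>R\<^sub>F\<close> amounts to the algebraic independence of the components of \<open>F\<close>. The
  polynomials \<open>H\<close> with \<open>H \<circ> F = 0\<close> are closed under both partial derivatives: by the chain rule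
  the gradient of \<open>H\<close>, evaluated along \<open>F\<close>, is annihilated by the invertible Jacobian matrix of
  \<open>F\<close>. If such an \<open>H\<close> were nonzero, differentiating it often enough would yield a nonzero constant.
\<close>

lemma eval2_simps [simp]:
  "eval2 0 z = 0" "eval2 1 z = 1"
  "eval2 (p - q) z = eval2 p z - eval2 q z"
  "eval2 (p * q) z = eval2 p z * eval2 q z"
  by (cases z; simp add: eval2_def)+

lemma eval2_pCons: "eval2 (pCons a p) (x, y) = poly a x + y * eval2 p (x, y)"
  by (simp add: eval2_def)

lemma pderiv_X_0 [simp]: "pderiv_X 0 = 0"
  by (simp add: pderiv_X_def)

lemma pderiv_X_pCons: "pderiv_X (pCons a p) = pCons (pderiv a) (pderiv_X p)"
  by (simp add: pderiv_X_def map_poly_pCons)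

text \<open>Induction on \<open>H\<close> as a polynomial in Y: the one-variable chain rule handles
  the constant coefficient, the product rule the factor Y. Differentiating along arbitrary curves
  lets one lemma give both the partial derivatives and the chain rule for \<open>H\<close> composed
  with a mapping.\<close>

lemma DERIV_eval2:
  assumes "(f has_field_derivative f') (at t)" and "(g has_field_derivative g') (at t)"
  shows "((\<lambda>t. eval2 H (f t, g t)) has_field_derivative
           eval2 (pderiv_X H) (f t, g t) * f' + eval2 (pderiv_Y H) (f t, g t) * g') (at t)"
proof (induction H)
  case 0
  show ?case by simp
next
  case (pCons a H)
  have "((\<lambda>t. poly a (f t)) has_field_derivative poly (pderiv a) (f t) * f') (at t)"
    using DERIV_chain2[OF poly_DERIV assms(1)] .
  note DERIV_add[OF this DERIV_mult[OF assms(2) pCons.IH]]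
  moreover have "eval2 (p + q) z = eval2 p z + eval2 q z" for p q z
    by (cases z) (simp add: eval2_def)
  ultimately show ?case
    by (simp add: eval2_pCons pderiv_X_pCons pderiv_pCons algebra_simps)
qed

lemma vanishing_pderivs:
  assumes jac: "jacobian_det P Q = 1"
    and zero: "\<And>z. eval2 H (poly_mapping2 P Q z) = 0"
  shows "eval2 (pderiv_X H) (poly_mapping2 P Q z) = 0"
    and "eval2 (pderiv_Y H) (poly_mapping2 P Q z) = 0"
proof -
  obtain x y where z: "z = (x, y)" by fastforce
  define h k where "h = eval2 (pderiv_X H) (poly_mapping2 P Q z)"
    and "k = eval2 (pderiv_Y H) (poly_mapping2 P Q z)"
  have H0: "eval2 H (eval2 P w, eval2 Q w) = 0" for w
    using zero[of w] by (simp add: poly_mapping2_def)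
  \<comment> \<open>Freezing one coordinate makes its term in the chain rule vanish, which leaves a
    formal partial derivative.\<close>
  have dX: "((\<lambda>t. eval2 p (t, y)) has_field_derivative eval2 (pderiv_X p) z) (at x)" for p
    using DERIV_eval2[OF DERIV_ident DERIV_const[where k = y], where H = p and t = x] by (simp add: z)
  have dY: "((\<lambda>t. eval2 p (x, t)) has_field_derivative eval2 (pderiv_Y p) z) (at y)" for p
    using DERIV_eval2[OF DERIV_const[where k = x] DERIV_ident, where H = p and t = y] by (simp add: z)
  \<comment> \<open>By \<open>H0\<close> the function being differentiated is constantly 0, so its
    derivative is both 0 and the chain rule expression.\<close>
  have 1: "h * eval2 (pderiv_X P) z + k * eval2 (pderiv_X Q) z = 0"
    using DERIV_unique[OF DERIV_eval2[OF dX[of P] dX[of Q], where H = H]]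
    by (simp add: H0 h_def k_def poly_mapping2_def z)
  have 2: "h * eval2 (pderiv_Y P) z + k * eval2 (pderiv_Y Q) z = 0"
    using DERIV_unique[OF DERIV_eval2[OF dY[of P] dY[of Q], where H = H]]
    by (simp add: H0 h_def k_def poly_mapping2_def z)
  have 3: "eval2 (pderiv_X P) z * eval2 (pderiv_Y Q) z
             - eval2 (pderiv_Y P) z * eval2 (pderiv_X Q) z = 1"
    using arg_cong[OF jac, of "\<lambda>p. eval2 p z"] by (simp add: jacobian_det_def)
  \<comment> \<open>Cramer's rule: eliminating \<open>k\<close> from \<open>1\<close> and
    \<open>2\<close> leaves \<open>h\<close> times the determinant, which is 1 by \<open>3\<close>;
    likewise for \<open>k\<close>.\<close>
  have "h = 0" using 1 2 3 by algebra
  moreover have "k = 0" using 1 2 3 by algebra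
  ultimately show "eval2 (pderiv_X H) (poly_mapping2 P Q z) = 0"
    and "eval2 (pderiv_Y H) (poly_mapping2 P Q z) = 0"
    by (simp_all add: h_def k_def)
qed

text \<open>Two nested inductions, first on the degree in Y, then on the degree in X. In
  characteristic 0 a zero derivative forces degree 0, so each induction hypothesis, applied to the
  derivative, removes one variable.\<close>

lemma vanishing_imp_zero:
  assumes jac: "jacobian_det P Q = 1"
    and "\<And>z. eval2 H (poly_mapping2 P Q z) = 0"
  shows "H = 0"
  using assms(2)
proof (induction "degree H" arbitrary: H rule: less_induct)
  case less
  have "degree H = 0"
  proof (rule ccontr)
    assume "degree H \<noteq> 0"
    then have "pderiv_Y H = 0"
      by (intro less.hyps vanishing_pderivs(2)[OF jac less.prems]) (simp add: degree_pderiv)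
    with \<open>degree H \<noteq> 0\<close> show False by (simp add: pderiv_eq_0_iff)
  qed
  then obtain a where H: "H = [:a:]" by (rule degree_eq_zeroE)
  have "a = 0" if "\<And>z. eval2 [:a:] (poly_mapping2 P Q z) = 0" for a
    using that
  proof (induction "degree a" arbitrary: a rule: less_induct)
    case (less a)
    have "eval2 [:pderiv a:] (poly_mapping2 P Q z) = 0" for z
      using vanishing_pderivs(1)[OF jac less.prems, of z]
      by (simp add: pderiv_X_pCons)
    with less.hyps[of "pderiv a"] have "degree a = 0"
      by (cases "degree a = 0") (auto simp: degree_pderiv pderiv_eq_0_iff)
    then obtain c where "a = [:c:]" by (rule degree_eq_zeroE)
    \<comment> \<open>Any point would do, since the remaining polynomial is the constant
      \<open>c\<close>.\<close>
    with less.prems[of "(0, 0)"] show ?case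
      by (simp add: poly_mapping2_def eval2_pCons)
  qed
  with less.prems show ?case by (simp add: H)
qed

theorem proposition3p2:
  fixes F :: "complex \<times> complex \<Rightarrow> complex \<times> complex"
  assumes "F \<in> et"
  shows "inj_on (right_comp F) et"
proof (rule inj_onI)
  fix G G' assume "G \<in> et" "G' \<in> et" and eq: "right_comp F G = right_comp F G'"
  then obtain A B A' B' where G: "G = poly_mapping2 A B" "G' = poly_mapping2 A' B'"
    by (auto simp: et_def)
  obtain P Q where F: "F = poly_mapping2 P Q" and jac: "jacobian_det P Q = 1"
    using assms by (auto simp: et_def)
  have "G (F z) = G' (F z)" for z
    using fun_cong[OF eq, of z] by (simp add: right_comp_def)
  \<comment> \<open>Componentwise, agreement of \<open>G\<close> and \<open>G'\<close> along
    \<open>F\<close> says that these differences vanish along \<open>F\<close>.\<close>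
  then have "A - A' = 0" "B - B' = 0"
    by (intro vanishing_imp_zero[OF jac]; simp add: G F poly_mapping2_def)+
  then show "G = G'" by (simp add: G)
qed

end
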